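(* Fix a level $c$ of $C$. Assume that for all $a,a^*\in\{0,1\}$ and all $m$, $$Y_{am}\perp A\mid (C,U),\quad Y_{am}\perp M\mid (A,C,U),\quad M_a\perp A\mid (C,U),\quad Y_{am}\perp M_{a^*}\mid (C,U),$$ and that $A\perp U\mid C$. Suppose the observed conditional natural direct effect is reduced to the true one, i.e. $\mathrm{NDE}^{\mathrm{obs}}_{\mathrm{RR}|c}>\mathrm{NDE}^{\mathrm{true}}_{\mathrm{RR}|c}>0$. Then $$\mathrm{RR}_{AU|(M,c)}\ge \frac{\mathrm{NDE}^{\mathrm{obs}}_{\mathrm{RR}|c}}{\mathrm{NDE}^{\mathrm{true}}_{\mathrm{RR}|c}},\qquad \mathrm{RR}_{UY|(A=1,M,c)}\ge \frac{\mathrm{NDE}^{\mathrm{obs}}_{\mathrm{RR}|c}}{\mathrm{NDE}^{\mathrm{true}}_{\mathrm{RR}|c}},$$ and $$\max\left\{\mathrm{RR}_{AU|(M,c)},\mathrm{RR}_{UY|(A=1,M,c)}\right\}\ge \left[\mathrm{NDE}^{\mathrm{obs}}_{\mathrm{RR}|c}+\left\{\mathrm{NDE}^{\mathrm{obs}}_{\mathrm{RR}|c}\left(\mathrm{NDE}^{\mathrm{obs}}_{\mathrm{RR}|c}-\mathrm{NDE}^{\mathrm{true}}_{\mathrm{RR}|c}\right)\right\}^{1/2}\right]\Big/\mathrm{NDE}^{\mathrm{true}}_{\mathrm{RR}|c}.$$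
   Context: Setting. $A\in\{0,1\}$ is a binary exposure, $Y\in\{0,1\}$ a binary outcome, $M$ a categorical mediator, $C$ categorical observed baseline covariates and $U$ categorical unmeasured baseline covariates ($M$, $C$, $U$ take finitely many values; they may be vectors). $Y_a$ and $M_a$ are the potential outcome and potential mediator under exposure $a$; $Y_{am}$ is the potential outcome under exposure $a$ and mediator value $m$; $Y_{aM_{a^*}}$ is the potential outcome under exposure $a$ with the mediator set to $M_{a^*}$. Consistency: $Y_a=Y$ and $M_a=M$ if $A=a$; $Y_{am}=Y$ if $A=a$ and $M=m$. Composition: $Y_{aM_a}=Y_a$ for $a=0,1$. The symbol $\perp$ denotes (conditional) independence; lower-case $m,c,u$ in conditional probabilities stand for the events $M=m$, $C=c$, $U=u$. Effects. $\mathrm{NDE}^{\mathrm{true}}_{\mathrm{RR}|c}=\dfrac{P(Y_{1M_0}=1\mid c)}{P(Y_{0M_0}=1\mid c)}$ and $\mathrm{NDE}^{\mathrm{obs}}_{\mathrm{RR}|c}=\dfrac{\sum_m P(Y=1\mid A=1,m,c)P(m\mid A=0,c)}{\sum_m P(Y=1\mid A=0,m,c)P(m\mid A=0,c)}$. Sensitivity parameters. $$\mathrm{RR}_{UY|(A=1,M,c)}=\max_m\frac{\max_u P(Y=1\mid A=1,m,c,u)}{\min_u P(Y=1\mid A=1,m,c,u)},\qquad \mathrm{RR}_{AU|(M,c)}=\max_m\max_u\frac{P(u\mid A=1,m,c)}{P(u\mid A=0,m,c)}.$$ Conventions. $P(C=c)>0$, $P(A=a\mid c)>0$ for $a=0,1$,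 and $P(m\mid A=1,c)>0$ whenever $P(m\mid A=0,c)>0$; denominators in the effects are positive. Maxima over $m$ are over $m$ with $P(m\mid A=0,c)>0$; $u$ ranges over values with $P(u\mid c)>0$. $P(Y=1\mid A=a,m,c,u)$ is understood as $P(Y_{am}=1\mid c,u)$ (with which it coincides under the independence assumptions) when its conditioning event has probability zero. A positive number over $0$ is $+\infty$ (so the sensitivity parameters take values in $[1,\infty]$); ratios $0/0$ are omitted from the maximum defining $\mathrm{RR}_{AU|(M,c)}$ and are read as $1$ in $\mathrm{RR}_{UY|(A=1,M,c)}$. *)

theory Defs
  imports "HOL-Probability.Probability"
begin

(* Binary variables have type bool, with True for 1 and False for 0. *)

(* Testing single values suffices because all variables have finite types. *)
definition cond_indep ::
  "'w measure \<Rightarrow> ('w \<Rightarrow> 'a::finite) \<Rightarrow> ('w \<Rightarrow> 'b::finite) \<Rightarrow> ('w \<Rightarrow> 'd::finite) \<Rightarrow> bool" where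
  "cond_indep \<mu> V W Z \<longleftrightarrow>
     (\<forall>v w z. \<P>(\<omega> in \<mu>. Z \<omega> = z) > 0 \<longrightarrow>
        \<P>(\<omega> in \<mu>. V \<omega> = v \<and> W \<omega> = w \<bar> Z \<omega> = z)
          = \<P>(\<omega> in \<mu>. V \<omega> = v \<bar> Z \<omega> = z) * \<P>(\<omega> in \<mu>. W \<omega> = w \<bar> Z \<omega> = z))"

(* nested_outcome Yam Ma a a' is the outcome under exposure a with the mediator set to
   the value it would take under exposure a'. *)
definition nested_outcome ::
  "(bool \<Rightarrow> 'm \<Rightarrow> 'w \<Rightarrow> bool) \<Rightarrow> (bool \<Rightarrow> 'w \<Rightarrow> 'm) \<Rightarrow> bool \<Rightarrow> bool \<Rightarrow> 'w \<Rightarrow> bool" where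
  "nested_outcome Yam Ma a a' \<omega> = Yam a (Ma a' \<omega>) \<omega>"

(* Ya, Ma and Yam are the potential variables under an exposure, or under an exposure and
   a mediator value. *)
locale mediation = prob_space \<mu> for \<mu> :: "'w measure" +
  fixes A Y :: "'w \<Rightarrow> bool"
    and M :: "'w \<Rightarrow> 'm::finite"
    and C :: "'w \<Rightarrow> 'c::finite"
    and U :: "'w \<Rightarrow> 'u::finite"
    and Ya :: "bool \<Rightarrow> 'w \<Rightarrow> bool"
    and Ma :: "bool \<Rightarrow> 'w \<Rightarrow> 'm"
    and Yam :: "bool \<Rightarrow> 'm \<Rightarrow> 'w \<Rightarrow> bool"
  assumes measurable_A: "A \<in> measurable \<mu> (count_space UNIV)"
    and measurable_Y: "Y \<in> measurable \<mu> (count_space UNIV)"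
    and measurable_M: "M \<in> measurable \<mu> (count_space UNIV)"
    and measurable_C: "C \<in> measurable \<mu> (count_space UNIV)"
    and measurable_U: "U \<in> measurable \<mu> (count_space UNIV)"
    and measurable_Ya: "Ya a \<in> measurable \<mu> (count_space UNIV)"
    and measurable_Ma: "Ma a \<in> measurable \<mu> (count_space UNIV)"
    and measurable_Yam: "Yam a m \<in> measurable \<mu> (count_space UNIV)"
    and consistency_Ya: "\<lbrakk>\<omega> \<in> space \<mu>; A \<omega> = a\<rbrakk> \<Longrightarrow> Ya a \<omega> = Y \<omega>"
    and consistency_Ma: "\<lbrakk>\<omega> \<in> space \<mu>; A \<omega> = a\<rbrakk> \<Longrightarrow> Ma a \<omega> = M \<omega>"
    and consistency_Yam: "\<lbrakk>\<omega> \<in> space \<mu>; A \<omega> = a; M \<omega> = m\<rbrakk> \<Longrightarrow> Yam a m \<omega> = Y \<omega>"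
    and composition: "\<omega> \<in> space \<mu> \<Longrightarrow> nested_outcome Yam Ma a a \<omega> = Ya a \<omega>"

definition NDE_true ::
  "'w measure \<Rightarrow> ('w \<Rightarrow> 'c) \<Rightarrow> (bool \<Rightarrow> 'w \<Rightarrow> 'm) \<Rightarrow> (bool \<Rightarrow> 'm \<Rightarrow> 'w \<Rightarrow> bool) \<Rightarrow> 'c \<Rightarrow> real" where
  "NDE_true \<mu> C Ma Yam c =
     \<P>(\<omega> in \<mu>. nested_outcome Yam Ma True False \<omega> \<bar> C \<omega> = c)
     / \<P>(\<omega> in \<mu>. nested_outcome Yam Ma False False \<omega> \<bar> C \<omega> = c)"

(* The mean of Y under exposure a, standardized to the mediator distribution of the unexposed.
   A summand whose first conditioning event is null but whose mediator weight is zero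
   contributes nothing. *)
definition standardized_risk ::
  "'w measure \<Rightarrow> ('w \<Rightarrow> bool) \<Rightarrow> ('w \<Rightarrow> bool) \<Rightarrow> ('w \<Rightarrow> 'm::finite) \<Rightarrow> ('w \<Rightarrow> 'c) \<Rightarrow> bool \<Rightarrow> 'c \<Rightarrow> real" where
  "standardized_risk \<mu> A Y M C a c =
     (\<Sum>m\<in>UNIV. \<P>(\<omega> in \<mu>. Y \<omega> \<bar> A \<omega> = a \<and> M \<omega> = m \<and> C \<omega> = c)
        * \<P>(\<omega> in \<mu>. M \<omega> = m \<bar> A \<omega> = False \<and> C \<omega> = c))"

definition NDE_obs ::
  "'w measure \<Rightarrow> ('w \<Rightarrow> bool) \<Rightarrow> ('w \<Rightarrow> bool) \<Rightarrow> ('w \<Rightarrow> 'm::finite) \<Rightarrow> ('w \<Rightarrow> 'c) \<Rightarrow> 'c \<Rightarrow> real" where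
  "NDE_obs \<mu> A Y M C c =
     standardized_risk \<mu> A Y M C True c / standardized_risk \<mu> A Y M C False c"

(* Intended for nonnegative arguments. *)
definition ratio :: "real \<Rightarrow> real \<Rightarrow> ereal" where
  "ratio x y = (if y = 0 then (if x = 0 then 1 else \<infinity>) else ereal (x / y))"

definition outcome_prob ::
  "'w measure \<Rightarrow> ('w \<Rightarrow> bool) \<Rightarrow> ('w \<Rightarrow> bool) \<Rightarrow> ('w \<Rightarrow> 'm) \<Rightarrow> ('w \<Rightarrow> 'c) \<Rightarrow> ('w \<Rightarrow> 'u)
     \<Rightarrow> (bool \<Rightarrow> 'm \<Rightarrow> 'w \<Rightarrow> bool) \<Rightarrow> bool \<Rightarrow> 'm \<Rightarrow> 'c \<Rightarrow> 'u \<Rightarrow> real" where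
  "outcome_prob \<mu> A Y M C U Yam a m c u =
     (if \<P>(\<omega> in \<mu>. A \<omega> = a \<and> M \<omega> = m \<and> C \<omega> = c \<and> U \<omega> = u) = 0
      then \<P>(\<omega> in \<mu>. Yam a m \<omega> \<bar> C \<omega> = c \<and> U \<omega> = u)
      else \<P>(\<omega> in \<mu>. Y \<omega> \<bar> A \<omega> = a \<and> M \<omega> = m \<and> C \<omega> = c \<and> U \<omega> = u))"

definition mediator_levels ::
  "'w measure \<Rightarrow> ('w \<Rightarrow> bool) \<Rightarrow> ('w \<Rightarrow> 'm) \<Rightarrow> ('w \<Rightarrow> 'c) \<Rightarrow> 'c \<Rightarrow> 'm set" where
  "mediator_levels \<mu> A M C c = {m. \<P>(\<omega> in \<mu>. M \<omega> = m \<bar> A \<omega> = False \<and> C \<omega> = c) > 0}"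

definition confounder_levels ::
  "'w measure \<Rightarrow> ('w \<Rightarrow> 'c) \<Rightarrow> ('w \<Rightarrow> 'u) \<Rightarrow> 'c \<Rightarrow> 'u set" where
  "confounder_levels \<mu> C U c = {u. \<P>(\<omega> in \<mu>. U \<omega> = u \<bar> C \<omega> = c) > 0}"

definition RR_UY ::
  "'w measure \<Rightarrow> ('w \<Rightarrow> bool) \<Rightarrow> ('w \<Rightarrow> bool) \<Rightarrow> ('w \<Rightarrow> 'm::finite) \<Rightarrow> ('w \<Rightarrow> 'c) \<Rightarrow> ('w \<Rightarrow> 'u::finite)
     \<Rightarrow> (bool \<Rightarrow> 'm \<Rightarrow> 'w \<Rightarrow> bool) \<Rightarrow> 'c \<Rightarrow> ereal" where
  "RR_UY \<mu> A Y M C U Yam c =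
     (MAX m\<in>mediator_levels \<mu> A M C c.
        ratio (MAX u\<in>confounder_levels \<mu> C U c. outcome_prob \<mu> A Y M C U Yam True m c u)
              (MIN u\<in>confounder_levels \<mu> C U c. outcome_prob \<mu> A Y M C U Yam True m c u))"

definition confounder_prob ::
  "'w measure \<Rightarrow> ('w \<Rightarrow> bool) \<Rightarrow> ('w \<Rightarrow> 'm) \<Rightarrow> ('w \<Rightarrow> 'c) \<Rightarrow> ('w \<Rightarrow> 'u)
     \<Rightarrow> bool \<Rightarrow> 'm \<Rightarrow> 'c \<Rightarrow> 'u \<Rightarrow> real" where
  "confounder_prob \<mu> A M C U a m c u =
     \<P>(\<omega> in \<mu>. U \<omega> = u \<bar> A \<omega> = a \<and> M \<omega> = m \<and> C \<omega> = c)"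

(* The inner maximum omits the indeterminate ratios 0/0. *)
definition RR_AU ::
  "'w measure \<Rightarrow> ('w \<Rightarrow> bool) \<Rightarrow> ('w \<Rightarrow> 'm::finite) \<Rightarrow> ('w \<Rightarrow> 'c) \<Rightarrow> ('w \<Rightarrow> 'u::finite) \<Rightarrow> 'c \<Rightarrow> ereal" where
  "RR_AU \<mu> A M C U c =
     (MAX m\<in>mediator_levels \<mu> A M C c.
        MAX u\<in>{u \<in> confounder_levels \<mu> C U c.
              \<not> (confounder_prob \<mu> A M C U True m c u = 0
                 \<and> confounder_prob \<mu> A M C U False m c u = 0)}.
          ratio (confounder_prob \<mu> A M C U True m c u) (confounder_prob \<mu> A M C U False m c u))"

end

theory Submission
  imports Defs
begin

text \<open>
  Everything happens inside the stratum of the fixed covariate level \<open>c\<close>. Write \<open>f\<^sub>m u\<close> for the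
  risk of \<open>Y\<^bsub>1m\<^esub>\<close> given \<open>U = u\<close>, \<open>w m\<close> for the mediator distribution of the unexposed, and \<open>p\<^sub>a\<close> for
  the distribution of \<open>U\<close> given \<open>A = a\<close> and \<open>M = m\<close>. The independence assumptions turn both effects
  into standardized risks. The two denominators agree (\<open>nested_risk_eq\<close> and \<open>standardized_risk_eq\<close>
  for the unexposed: with both the outcome and the mediator unexposed, adjusting for \<open>U\<close> changes
  nothing). The observed numerator is the \<open>w\<close>-mixture of the \<open>p\<^sub>1\<close>-means of \<open>f\<^sub>m\<close>, whereas the true
  numerator is the \<open>w\<close>-mixture of its \<open>p\<^sub>0\<close>-means. Although exposure and confounder are independent,
  conditioning on the mediator makes \<open>p\<^sub>1\<close> and \<open>p\<^sub>0\<close> differ, and this is the only source of bias.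

  Hence \<open>\<rho>\<close>, the observed effect divided by the true one, is a ratio of two mixtures with the same
  weights, so in some single mediator stratum the \<open>p\<^sub>1\<close>-mean of \<open>f\<^sub>m\<close> is at least \<open>\<rho>\<close> times the
  \<open>p\<^sub>0\<close>-mean (\<open>exists_weighted_term_ge\<close>). If there \<open>p\<^sub>1 \<le> x p\<^sub>0\<close> pointwise and \<open>f\<^sub>m\<close> varies by a factor
  of at most \<open>y\<close>, then \<open>\<rho> \<le> x\<close> and \<open>\<rho> \<le> y\<close>, and \<open>weighted_means_bound\<close> gives the bounding-factor
  inequality \<open>\<rho> \<le> x y / (x + y - 1)\<close>. With \<open>x = y = z\<close> the latter is a quadratic inequality in \<open>z\<close>
  whose solution is the bound on the maximum of the two parameters (\<open>sharp_root_bound\<close>).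

  The sensitivity parameters may be infinite. They are therefore only ever compared with real upper
  bounds \<open>x\<close>, \<open>y\<close> and \<open>z\<close>, and \<open>ereal_le_if_le_real_upper_bounds\<close> carries the result over.
\<close>

section \<open>Ratios of weighted means\<close>

text \<open>Multiplying out makes the conventions for a zero denominator disappear: a ratio read as
  \<open>\<infinity>\<close> has no real upper bound, and in the case \<open>0/0\<close> both sides vanish.\<close>

lemma ratio_le_imp_le_mult:
  assumes "ratio p q \<le> ereal z" and "0 \<le> q"
  shows "p \<le> z * q"
  using assms by (auto simp: ratio_def divide_simps split: if_splits)

lemma ereal_le_if_le_real_upper_bounds:
  fixes R :: ereal
  assumes "\<And>z. R \<le> ereal z \<Longrightarrow> b \<le> z"
  shows "ereal b \<le> R"
proof (rule ccontr)
  assume "\<not> ereal b \<le> R"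
  then obtain z where "R < ereal z" "z < b"
    using ereal_dense2[of R "ereal b"] by (auto simp: not_le)
  with assms[OF less_imp_le, of z] show False by simp
qed

text \<open>
  This is the bounding-factor inequality behind E-values. Split \<open>f\<close> into its floor \<open>g\<close> and the excess
  \<open>f - g\<close>. The floor contributes \<open>g\<close> to both means, so the whole discrepancy sits in the mean excesses
  \<open>s\<^sub>1\<close> and \<open>s\<^sub>0\<close>. These satisfy \<open>s\<^sub>1 \<le> x s\<^sub>0\<close> because \<open>p\<^sub>1 \<le> x p\<^sub>0\<close>, and \<open>s\<^sub>1 \<le> (y - 1) g\<close> because the
  excess is at most \<open>(y - 1) g\<close>; eliminating \<open>s\<^sub>0\<close> and \<open>s\<^sub>1\<close> leaves the claim times \<open>g\<close>.
\<close>

lemma weighted_means_bound: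
  fixes p\<^sub>0 p\<^sub>1 f :: "'u \<Rightarrow> real"
  assumes p\<^sub>0: "sum p\<^sub>0 V = 1"
    and p\<^sub>1: "\<And>u. u \<in> V \<Longrightarrow> 0 \<le> p\<^sub>1 u" "sum p\<^sub>1 V = 1"
    and f: "\<And>u. u \<in> V \<Longrightarrow> g \<le> f u" "\<And>u. u \<in> V \<Longrightarrow> f u \<le> y * g"
    and px: "\<And>u. u \<in> V \<Longrightarrow> p\<^sub>1 u \<le> x * p\<^sub>0 u"
    and rho: "1 \<le> \<rho>" "\<rho> \<le> x"
    and g: "0 < g"
    and le: "\<rho> * (\<Sum>u\<in>V. f u * p\<^sub>0 u) \<le> (\<Sum>u\<in>V. f u * p\<^sub>1 u)"
  shows "\<rho> * (x + y - 1) \<le> x * y"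
proof -
  define s where "s p = (\<Sum>u\<in>V. (f u - g) * p u)" for p :: "'u \<Rightarrow> real"
  have mean: "(\<Sum>u\<in>V. f u * p u) = g + s p" if "sum p V = 1" for p
    using that by (simp add: s_def left_diff_distrib sum_subtractf flip: sum_distrib_left)
  have "s p\<^sub>1 \<le> (\<Sum>u\<in>V. x * ((f u - g) * p\<^sub>0 u))"
    unfolding s_def
  proof (rule sum_mono)
    fix u assume "u \<in> V"
    then show "(f u - g) * p\<^sub>1 u \<le> x * ((f u - g) * p\<^sub>0 u)"
      using mult_left_mono[OF px[of u], of "f u - g"] f(1)[of u] by (simp add: algebra_simps)
  qed
  then have s1: "s p\<^sub>1 \<le> x * s p\<^sub>0"
    by (simp add: s_def sum_distrib_left)
  have "s p\<^sub>1 \<le> (\<Sum>u\<in>V. (y - 1) * g * p\<^sub>1 u)"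
    unfolding s_def using f(2) p\<^sub>1(1)
    by (intro sum_mono mult_right_mono) (auto simp: algebra_simps)
  then have s2: "s p\<^sub>1 \<le> (y - 1) * g"
    using p\<^sub>1(2) by (simp flip: sum_distrib_left)
  have "\<rho> * (g + s p\<^sub>0) \<le> g + s p\<^sub>1"
    using le mean[OF p\<^sub>0] mean[OF p\<^sub>1(2)] by simp
  then have "x * (\<rho> * (g + s p\<^sub>0)) \<le> x * (g + s p\<^sub>1)"
    using rho by (intro mult_left_mono) auto
  moreover have "\<rho> * s p\<^sub>1 \<le> \<rho> * (x * s p\<^sub>0)"
    using s1 rho by (intro mult_left_mono) auto
  moreover have "(x - \<rho>) * s p\<^sub>1 \<le> (x - \<rho>) * ((y - 1) * g)"
    using s2 rho by (intro mult_left_mono) auto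
  ultimately have "(\<rho> * (x + y - 1)) * g \<le> (x * y) * g"
    by (simp add: algebra_simps)
  then show ?thesis
    using g by simp
qed

text \<open>The third hypothesis says \<open>(z - \<rho>)\<^sup>2 \<ge> \<rho> (\<rho> - 1)\<close>; since \<open>\<rho> \<le> z\<close>, only the larger root is
  relevant.\<close>

lemma sharp_root_bound:
  fixes \<rho> z :: real
  assumes "1 \<le> \<rho>" "\<rho> \<le> z" "\<rho> * (2 * z - 1) \<le> z * z"
  shows "\<rho> + sqrt (\<rho> * (\<rho> - 1)) \<le> z"
proof -
  have "sqrt (\<rho> * (\<rho> - 1)) \<le> z - \<rho>"
    using assms by (intro real_le_lsqrt) (auto simp: power2_eq_square algebra_simps)
  then show ?thesis by simp
qed

text \<open>The ratio of two mixtures with common weights is at most the largest ratio of their components.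
  The component found must moreover be positive, since otherwise it might satisfy \<open>\<rho> * 0 \<le> 0\<close> and
  carry no information.\<close>

lemma exists_weighted_term_ge:
  fixes w a b :: "'m \<Rightarrow> real"
  assumes fin: "finite L"
    and w: "\<And>m. m \<in> L \<Longrightarrow> 0 < w m"
    and b: "\<And>m. m \<in> L \<Longrightarrow> 0 \<le> b m" and rho: "0 \<le> \<rho>"
    and le: "\<rho> * (\<Sum>m\<in>L. w m * b m) \<le> (\<Sum>m\<in>L. w m * a m)"
    and pos: "0 < (\<Sum>m\<in>L. w m * a m)"
  obtains m where "m \<in> L" "\<rho> * b m \<le> a m" "0 < a m"
proof (rule ccontr)
  assume "\<not> thesis"
  then have none: "a m < \<rho> * b m \<or> a m \<le> 0" if "m \<in> L" for m
    using that \<open>\<And>m. \<lbrakk>m \<in> L; \<rho> * b m \<le> a m; 0 < a m\<rbrakk> \<Longrightarrow> thesis\<close> by force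
  have le1: "a m \<le> \<rho> * b m" if "m \<in> L" for m
    using none[OF that] mult_nonneg_nonneg[OF rho b[OF that]] by linarith
  obtain m where m: "m \<in> L" "0 < w m * a m"
    using pos sum_nonpos[of L "\<lambda>m. w m * a m"] by (meson not_le)
  with w have "0 < a m" using zero_less_mult_pos by blast
  with none m w have "w m * a m < w m * (\<rho> * b m)" by fastforce
  then have "(\<Sum>m\<in>L. w m * a m) < (\<Sum>m\<in>L. w m * (\<rho> * b m))"
    using fin m le1 w by (intro sum_strict_mono_ex1) (auto intro: mult_left_mono less_imp_le)
  with le show False by (simp add: sum_distrib_left mult_ac)
qed

section \<open>Conditional independence in terms of joint probabilities\<close>

lemma (in prob_space) prob_split_finite:
  fixes X :: "'a \<Rightarrow> 'x::finite"
  assumes [measurable]: "X \<in> measurable M (count_space UNIV)" "Measurable.pred M P"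
  shows "\<P>(\<omega> in M. P \<omega>) = (\<Sum>x\<in>UNIV. \<P>(\<omega> in M. P \<omega> \<and> X \<omega> = x))"
proof -
  have "{\<omega> \<in> space M. P \<omega>} = (\<Union>x\<in>UNIV. {\<omega> \<in> space M. P \<omega> \<and> X \<omega> = x})"
    by auto
  also have "prob \<dots> = (\<Sum>x\<in>UNIV. \<P>(\<omega> in M. P \<omega> \<and> X \<omega> = x))"
    by (rule finite_measure_finite_Union) (auto simp: disjoint_family_on_def)
  finally show ?thesis .
qed

lemma (in prob_space) prob_conj_eq_0:
  assumes "\<P>(\<omega> in M. Q \<omega>) = 0" and [measurable]: "Measurable.pred M Q"
  shows "\<P>(\<omega> in M. P \<omega> \<and> Q \<omega>) = 0"
proof -
  have "\<P>(\<omega> in M. P \<omega> \<and> Q \<omega>) \<le> \<P>(\<omega> in M. Q \<omega>)"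
    by (rule finite_measure_mono) auto
  with assms(1) show ?thesis
    by (simp add: measure_le_0_iff)
qed

text \<open>Clearing the denominators makes the product rule valid for null conditioning events too, where
  both sides are zero.\<close>

lemma (in prob_space) cond_indepD:
  fixes V :: "'a \<Rightarrow> 'v::finite" and W :: "'a \<Rightarrow> 'x::finite" and Z :: "'a \<Rightarrow> 'z::finite"
  assumes ci: "cond_indep M V W Z"
    and [measurable]: "Z \<in> measurable M (count_space UNIV)"
  shows "\<P>(\<omega> in M. V \<omega> = v \<and> W \<omega> = w \<and> Z \<omega> = z) * \<P>(\<omega> in M. Z \<omega> = z)
       = \<P>(\<omega> in M. V \<omega> = v \<and> Z \<omega> = z) * \<P>(\<omega> in M. W \<omega> = w \<and> Z \<omega> = z)"
proof (cases "\<P>(\<omega> in M. Z \<omega> = z) = 0")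
  case True
  then show ?thesis using prob_conj_eq_0[OF True] by simp
next
  case False
  then have "0 < \<P>(\<omega> in M. Z \<omega> = z)" by (simp add: zero_less_measure_iff)
  with ci[unfolded cond_indep_def, rule_format, of z v w] show ?thesis
    by (simp add: cond_prob_def conj_assoc field_simps)
qed

section \<open>Identification under no unmeasured confounding given \<open>C\<close> and \<open>U\<close>\<close>

locale unconfounded_mediation = mediation \<mu> A Y M C U Ya Ma Yam
  for \<mu> :: "'w measure" and A Y :: "'w \<Rightarrow> bool" and M :: "'w \<Rightarrow> 'm::finite"
    and C :: "'w \<Rightarrow> 'c::finite" and U :: "'w \<Rightarrow> 'u::finite"
    and Ya :: "bool \<Rightarrow> 'w \<Rightarrow> bool" and Ma :: "bool \<Rightarrow> 'w \<Rightarrow> 'm"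
    and Yam :: "bool \<Rightarrow> 'm \<Rightarrow> 'w \<Rightarrow> bool" +
  fixes c :: 'c
  assumes C_pos: "\<P>(\<omega> in \<mu>. C \<omega> = c) > 0"
    and A_pos: "\<P>(\<omega> in \<mu>. A \<omega> = a \<bar> C \<omega> = c) > 0"
    and Yam_A: "cond_indep \<mu> (Yam a m) A (\<lambda>\<omega>. (C \<omega>, U \<omega>))"
    and Yam_M: "cond_indep \<mu> (Yam a m) M (\<lambda>\<omega>. (A \<omega>, C \<omega>, U \<omega>))"
    and Ma_A: "cond_indep \<mu> (Ma a) A (\<lambda>\<omega>. (C \<omega>, U \<omega>))"
    and Yam_Ma: "cond_indep \<mu> (Yam a m) (Ma a') (\<lambda>\<omega>. (C \<omega>, U \<omega>))"
    and A_U: "cond_indep \<mu> A U C"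
begin

lemmas [measurable] = measurable_A measurable_Y measurable_M measurable_C measurable_U
  measurable_Ya measurable_Ma measurable_Yam

abbreviation joint :: "bool \<Rightarrow> 'm \<Rightarrow> 'u \<Rightarrow> real" where
  "joint a m u \<equiv> \<P>(\<omega> in \<mu>. A \<omega> = a \<and> M \<omega> = m \<and> C \<omega> = c \<and> U \<omega> = u)"

abbreviation risk :: "bool \<Rightarrow> 'm \<Rightarrow> 'u \<Rightarrow> real" where
  "risk a m u \<equiv> \<P>(\<omega> in \<mu>. Yam a m \<omega> \<bar> C \<omega> = c \<and> U \<omega> = u)"

lemma AC_pos: "\<P>(\<omega> in \<mu>. A \<omega> = a \<and> C \<omega> = c) > 0"
  using A_pos[of a] C_pos by (simp add: cond_prob_def zero_less_divide_iff)

text \<open>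
  By consistency \<open>Y\<close> is \<open>Yam a m\<close> on the event considered. Its independence of \<open>M\<close> given \<open>(A, C, U)\<close>
  removes the mediator from the conditioning event, and its independence of \<open>A\<close> given \<open>(C, U)\<close> then
  removes the exposure.
\<close>

lemma joint_outcome:
  "\<P>(\<omega> in \<mu>. Y \<omega> \<and> A \<omega> = a \<and> M \<omega> = m \<and> C \<omega> = c \<and> U \<omega> = u) = risk a m u * joint a m u"
proof -
  have "{\<omega> \<in> space \<mu>. Y \<omega> \<and> A \<omega> = a \<and> M \<omega> = m \<and> C \<omega> = c \<and> U \<omega> = u}
      = {\<omega> \<in> space \<mu>. Yam a m \<omega> \<and> M \<omega> = m \<and> A \<omega> = a \<and> C \<omega> = c \<and> U \<omega> = u}"
    using consistency_Yam[of _ a m] by auto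
  moreover have "joint a m u = \<P>(\<omega> in \<mu>. M \<omega> = m \<and> A \<omega> = a \<and> C \<omega> = c \<and> U \<omega> = u)"
    by (simp add: conj_left_commute)
  moreover have "\<P>(\<omega> in \<mu>. Yam a m \<omega> \<and> M \<omega> = m \<and> A \<omega> = a \<and> C \<omega> = c \<and> U \<omega> = u)
      * \<P>(\<omega> in \<mu>. A \<omega> = a \<and> C \<omega> = c \<and> U \<omega> = u)
    = \<P>(\<omega> in \<mu>. Yam a m \<omega> \<and> A \<omega> = a \<and> C \<omega> = c \<and> U \<omega> = u)
      * \<P>(\<omega> in \<mu>. M \<omega> = m \<and> A \<omega> = a \<and> C \<omega> = c \<and> U \<omega> = u)"
    using cond_indepD[OF Yam_M, of a m True m "(a, c, u)"] by simp
  moreover have "\<P>(\<omega> in \<mu>. Yam a m \<omega> \<and> A \<omega> = a \<and> C \<omega> = c \<and> U \<omega> = u)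
      * \<P>(\<omega> in \<mu>. C \<omega> = c \<and> U \<omega> = u)
    = \<P>(\<omega> in \<mu>. Yam a m \<omega> \<and> C \<omega> = c \<and> U \<omega> = u)
      * \<P>(\<omega> in \<mu>. A \<omega> = a \<and> C \<omega> = c \<and> U \<omega> = u)"
    using cond_indepD[OF Yam_A, of a m True a "(c, u)"] by simp
  moreover note
    prob_conj_eq_0[of "\<lambda>\<omega>. A \<omega> = a \<and> C \<omega> = c \<and> U \<omega> = u" "\<lambda>\<omega>. M \<omega> = m"]
    prob_conj_eq_0[of "\<lambda>\<omega>. A \<omega> = a \<and> C \<omega> = c \<and> U \<omega> = u" "\<lambda>\<omega>. Yam a m \<omega> \<and> M \<omega> = m"]
    prob_conj_eq_0[of "\<lambda>\<omega>. C \<omega> = c \<and> U \<omega> = u" "\<lambda>\<omega>. A \<omega> = a"]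
  (* Both conditioning probabilities d and e cancel; if one of them is zero, both sides are zero. *)
  moreover have "x = y' / e * j"
    if "x * d = y * j" "y * e = y' * d" "d = 0 \<Longrightarrow> j = 0" "d = 0 \<Longrightarrow> x = 0" "e = 0 \<Longrightarrow> d = 0"
    for x y y' d e j :: real
  proof (cases "d = 0")
    case False
    with that(5) have "e \<noteq> 0" by blast
    have "(x * e) * d = (y * e) * j" using that(1) by simp
    also have "\<dots> = (y' * j) * d" using that(2) by simp
    finally show ?thesis using False \<open>e \<noteq> 0\<close> by (simp add: field_simps)
  qed (use that in simp)
  ultimately show ?thesis
    by (simp add: cond_prob_def)
qed

text \<open>The two cases in the definition of the outcome probability agree, so that from here on the
  risk among potential outcomes can be used throughout.\<close>

lemma outcome_prob_eq_risk: "outcome_prob \<mu> A Y M C U Yam a m c u = risk a m u"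
  by (simp add: outcome_prob_def cond_prob_def[of _ Y] joint_outcome)

text \<open>
  The mediator distribution under exposure \<open>a\<close> can be read off from those actually exposed to \<open>a\<close>,
  as \<open>Ma a\<close> is independent of \<open>A\<close> given \<open>(C, U)\<close>. Independence of \<open>A\<close> and \<open>U\<close> given \<open>C\<close> makes the
  correction factor \<open>1 / P(A = a | c)\<close> free of \<open>u\<close>, and hence the mixture over \<open>u\<close> computable.
\<close>

lemma mediator_under_exposure:
  "\<P>(\<omega> in \<mu>. Ma a \<omega> = m \<and> C \<omega> = c \<and> U \<omega> = u)
     = joint a m u * \<P>(\<omega> in \<mu>. C \<omega> = c) / \<P>(\<omega> in \<mu>. A \<omega> = a \<and> C \<omega> = c)"
proof -
  have "{\<omega> \<in> space \<mu>. Ma a \<omega> = m \<and> A \<omega> = a \<and> C \<omega> = c \<and> U \<omega> = u}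
      = {\<omega> \<in> space \<mu>. A \<omega> = a \<and> M \<omega> = m \<and> C \<omega> = c \<and> U \<omega> = u}"
    using consistency_Ma[of _ a] by auto
  then have J: "joint a m u * \<P>(\<omega> in \<mu>. C \<omega> = c \<and> U \<omega> = u)
    = \<P>(\<omega> in \<mu>. Ma a \<omega> = m \<and> C \<omega> = c \<and> U \<omega> = u)
      * \<P>(\<omega> in \<mu>. A \<omega> = a \<and> C \<omega> = c \<and> U \<omega> = u)"
    using cond_indepD[OF Ma_A, of a m a "(c, u)"] by simp
  have AU: "\<P>(\<omega> in \<mu>. A \<omega> = a \<and> C \<omega> = c \<and> U \<omega> = u) * \<P>(\<omega> in \<mu>. C \<omega> = c)
    = \<P>(\<omega> in \<mu>. A \<omega> = a \<and> C \<omega> = c) * \<P>(\<omega> in \<mu>. C \<omega> = c \<and> U \<omega> = u)"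
    using cond_indepD[OF A_U, of a u c] by (simp add: conj_commute)
  show ?thesis
  proof (cases "\<P>(\<omega> in \<mu>. C \<omega> = c \<and> U \<omega> = u) = 0")
    case True
    with prob_conj_eq_0[OF True, of "\<lambda>\<omega>. Ma a \<omega> = m"]
      prob_conj_eq_0[OF True, of "\<lambda>\<omega>. A \<omega> = a \<and> M \<omega> = m"]
    show ?thesis by simp
  next
    case False
    from J have "joint a m u * \<P>(\<omega> in \<mu>. C \<omega> = c) * \<P>(\<omega> in \<mu>. C \<omega> = c \<and> U \<omega> = u)
      = \<P>(\<omega> in \<mu>. Ma a \<omega> = m \<and> C \<omega> = c \<and> U \<omega> = u)
        * (\<P>(\<omega> in \<mu>. A \<omega> = a \<and> C \<omega> = c \<and> U \<omega> = u) * \<P>(\<omega> in \<mu>. C \<omega> = c))"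
      by (simp add: mult_ac)
    with AU False AC_pos[of a] show ?thesis
      by (simp add: field_simps)
  qed
qed

lemma joint_sum_u: "(\<Sum>u\<in>UNIV. joint a m u) = \<P>(\<omega> in \<mu>. A \<omega> = a \<and> M \<omega> = m \<and> C \<omega> = c)"
  using prob_split_finite[of U "\<lambda>\<omega>. A \<omega> = a \<and> M \<omega> = m \<and> C \<omega> = c"] by simp

lemma joint_eq_0: "u \<notin> confounder_levels \<mu> C U c \<Longrightarrow> joint a m u = 0"
  using C_pos prob_conj_eq_0[of "\<lambda>\<omega>. C \<omega> = c \<and> U \<omega> = u" "\<lambda>\<omega>. A \<omega> = a \<and> M \<omega> = m"]
  by (simp add: confounder_levels_def cond_prob_def zero_less_divide_iff zero_less_measure_iff conj_ac)

abbreviation weight :: "'m \<Rightarrow> real" where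
  "weight m \<equiv> \<P>(\<omega> in \<mu>. M \<omega> = m \<bar> A \<omega> = False \<and> C \<omega> = c)"

text \<open>Two exposures are kept apart because the confounder distribution need not come from the group
  whose risk is averaged: the observed data give \<open>a' = a\<close>, while the nested counterfactual, whose
  mediator arises without exposure, needs \<open>a' = False\<close>.\<close>

abbreviation standardized_outcome :: "bool \<Rightarrow> bool \<Rightarrow> 'm \<Rightarrow> real" where
  "standardized_outcome a a' m \<equiv> (\<Sum>u\<in>confounder_levels \<mu> C U c.
     risk a m u * confounder_prob \<mu> A M C U a' m c u)"

lemma sum_confounders:
  "(\<Sum>u\<in>confounder_levels \<mu> C U c. h u * confounder_prob \<mu> A M C U a m c u)
     = (\<Sum>u\<in>UNIV. h u * joint a m u) / \<P>(\<omega> in \<mu>. A \<omega> = a \<and> M \<omega> = m \<and> C \<omega> = c)"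
proof -
  have cp: "confounder_prob \<mu> A M C U a m c u
      = joint a m u / \<P>(\<omega> in \<mu>. A \<omega> = a \<and> M \<omega> = m \<and> C \<omega> = c)" for u
    by (simp add: confounder_prob_def cond_prob_def conj_ac)
  have "(\<Sum>u\<in>confounder_levels \<mu> C U c. h u * joint a m u) = (\<Sum>u\<in>UNIV. h u * joint a m u)"
    by (rule sum.mono_neutral_left) (use joint_eq_0[of _ a m] in auto)
  then show ?thesis
    by (simp add: cp flip: sum_divide_distrib)
qed

lemma observed_outcome:
  "\<P>(\<omega> in \<mu>. Y \<omega> \<bar> A \<omega> = a \<and> M \<omega> = m \<and> C \<omega> = c) = standardized_outcome a a m"
  using prob_split_finite[of U "\<lambda>\<omega>. Y \<omega> \<and> A \<omega> = a \<and> M \<omega> = m \<and> C \<omega> = c"]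
  by (simp add: sum_confounders cond_prob_def[of _ Y] joint_outcome)

text \<open>Passing to the joint distribution removes the null mediator strata, in which the conditional
  distribution of \<open>U\<close> is a default value.\<close>

lemma weight_mult: "weight m * (\<Sum>u\<in>confounder_levels \<mu> C U c. h u * confounder_prob \<mu> A M C U False m c u)
   = (\<Sum>u\<in>UNIV. h u * joint False m u) / \<P>(\<omega> in \<mu>. A \<omega> = False \<and> C \<omega> = c)"
proof (cases "\<P>(\<omega> in \<mu>. A \<omega> = False \<and> M \<omega> = m \<and> C \<omega> = c) = 0")
  case True
  moreover have "joint False m u = 0" for u
    using prob_conj_eq_0[OF True, of "\<lambda>\<omega>. U \<omega> = u"] by (simp add: conj_ac)
  ultimately show ?thesis unfolding sum_confounders by simp
next
  case False
  then show ?thesis unfolding sum_confounders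
    by (simp add: cond_prob_def conj_left_commute)
qed

lemma sum_mediator_levels:
  "(\<Sum>m\<in>UNIV. weight m * h m) = (\<Sum>m\<in>mediator_levels \<mu> A M C c. weight m * h m)"
  by (rule sum.mono_neutral_right)
     (auto simp: mediator_levels_def cond_prob_def zero_less_divide_iff zero_less_measure_iff)

lemma standardized_risk_eq:
  "standardized_risk \<mu> A Y M C a c
     = (\<Sum>m\<in>mediator_levels \<mu> A M C c. weight m * standardized_outcome a a m)"
  unfolding standardized_risk_def observed_outcome sum_mediator_levels[symmetric]
  by (simp only: mult.commute)

text \<open>
  Split by the value \<open>m\<close> of the unexposed mediator and by \<open>u\<close>. On each cell the nested outcome is
  \<open>Yam a m\<close>, which given \<open>(C, U)\<close> is independent of \<open>Ma False\<close> even for \<open>a = True\<close>. This cross-world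
  independence factors the cell into the risk and the mediator probability.
\<close>

lemma nested_risk_eq:
  "\<P>(\<omega> in \<mu>. nested_outcome Yam Ma a False \<omega> \<bar> C \<omega> = c)
     = (\<Sum>m\<in>mediator_levels \<mu> A M C c. weight m * standardized_outcome a False m)"
proof -
  let ?N = "nested_outcome Yam Ma a False"
  have [measurable]: "Measurable.pred \<mu> ?N"
    unfolding nested_outcome_def by (rule measurable_compose_countable[where g="Ma False"]) measurable
  have cell: "\<P>(\<omega> in \<mu>. ((?N \<omega> \<and> C \<omega> = c) \<and> Ma False \<omega> = m) \<and> U \<omega> = u) / \<P>(\<omega> in \<mu>. C \<omega> = c)
      = risk a m u * joint False m u / \<P>(\<omega> in \<mu>. A \<omega> = False \<and> C \<omega> = c)" for m u
  proof -
    have "{\<omega> \<in> space \<mu>. ((?N \<omega> \<and> C \<omega> = c) \<and> Ma False \<omega> = m) \<and> U \<omega> = u}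
        = {\<omega> \<in> space \<mu>. Yam a m \<omega> \<and> Ma False \<omega> = m \<and> C \<omega> = c \<and> U \<omega> = u}"
      by (auto simp: nested_outcome_def)
    moreover have "\<P>(\<omega> in \<mu>. Yam a m \<omega> \<and> Ma False \<omega> = m \<and> C \<omega> = c \<and> U \<omega> = u)
        = risk a m u * \<P>(\<omega> in \<mu>. Ma False \<omega> = m \<and> C \<omega> = c \<and> U \<omega> = u)"
    proof (cases "\<P>(\<omega> in \<mu>. C \<omega> = c \<and> U \<omega> = u) = 0")
      case True
      with prob_conj_eq_0[OF True, of "\<lambda>\<omega>. Ma False \<omega> = m"]
        prob_conj_eq_0[OF True, of "\<lambda>\<omega>. Yam a m \<omega> \<and> Ma False \<omega> = m"]
      show ?thesis by simp
    next
      case False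
      with cond_indepD[OF Yam_Ma[where a=a and m=m and a'=False], of True m "(c, u)"] show ?thesis
        by (simp add: cond_prob_def field_simps)
    qed
    ultimately show ?thesis
      using C_pos by (simp add: mediator_under_exposure)
  qed
  have "\<P>(\<omega> in \<mu>. ?N \<omega> \<and> C \<omega> = c)
      = (\<Sum>m\<in>UNIV. \<P>(\<omega> in \<mu>. (?N \<omega> \<and> C \<omega> = c) \<and> Ma False \<omega> = m))"
    by (rule prob_split_finite) measurable
  also have "\<dots> = (\<Sum>m\<in>UNIV. \<Sum>u\<in>UNIV.
      \<P>(\<omega> in \<mu>. ((?N \<omega> \<and> C \<omega> = c) \<and> Ma False \<omega> = m) \<and> U \<omega> = u))"
    by (intro sum.cong refl prob_split_finite) measurable
  finally have "\<P>(\<omega> in \<mu>. ?N \<omega> \<bar> C \<omega> = c)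
      = (\<Sum>m\<in>UNIV. \<Sum>u\<in>UNIV.
          \<P>(\<omega> in \<mu>. ((?N \<omega> \<and> C \<omega> = c) \<and> Ma False \<omega> = m) \<and> U \<omega> = u)
            / \<P>(\<omega> in \<mu>. C \<omega> = c))"
    by (simp only: cond_prob_def sum_divide_distrib)
  also have "\<dots> = (\<Sum>m\<in>UNIV. weight m * standardized_outcome a False m)"
    by (simp only: cell weight_mult sum_divide_distrib)
  finally show ?thesis
    by (simp only: sum_mediator_levels)
qed

lemma confounder_prob_nonneg: "0 \<le> confounder_prob \<mu> A M C U a m c u"
  by (simp add: confounder_prob_def cond_prob_def)

lemma sum_confounder_prob:
  assumes "\<P>(\<omega> in \<mu>. M \<omega> = m \<bar> A \<omega> = a \<and> C \<omega> = c) > 0"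
  shows "(\<Sum>u\<in>confounder_levels \<mu> C U c. confounder_prob \<mu> A M C U a m c u) = 1"
proof -
  have "\<P>(\<omega> in \<mu>. A \<omega> = a \<and> M \<omega> = m \<and> C \<omega> = c) \<noteq> 0"
    using assms by (auto simp: cond_prob_def conj_left_commute)
  then show ?thesis
    using sum_confounders[of "\<lambda>_. 1" a m] joint_sum_u[of a m] by simp
qed

section \<open>Bounds within one mediator stratum\<close>

lemma confounder_prob_le:
  assumes "RR_AU \<mu> A M C U c \<le> ereal x"
    and m: "m \<in> mediator_levels \<mu> A M C c" and u: "u \<in> confounder_levels \<mu> C U c"
  shows "confounder_prob \<mu> A M C U True m c u \<le> x * confounder_prob \<mu> A M C U False m c u"
proof -
  let ?p = "\<lambda>a m u. confounder_prob \<mu> A M C U a m c u"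
  let ?L = "\<lambda>m. {u \<in> confounder_levels \<mu> C U c. \<not> (?p True m u = 0 \<and> ?p False m u = 0)}"
  show ?thesis
  proof (cases "u \<in> ?L m")
    case True
    then have "ratio (?p True m u) (?p False m u)
        \<le> (MAX u\<in>?L m. ratio (?p True m u) (?p False m u))"
      by (intro Max_ge) auto
    also have "\<dots> \<le> RR_AU \<mu> A M C U c"
      unfolding RR_AU_def using m by (intro Max_ge) auto
    also note assms(1)
    finally show ?thesis
      by (rule ratio_le_imp_le_mult) (rule confounder_prob_nonneg)
  qed (use u in auto)
qed

lemma risk_le:
  assumes "RR_UY \<mu> A Y M C U Yam c \<le> ereal y"
    and m: "m \<in> mediator_levels \<mu> A M C c" and ne: "confounder_levels \<mu> C U c \<noteq> {}"
  obtains g where "0 \<le> g"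
    and "\<And>u. u \<in> confounder_levels \<mu> C U c \<Longrightarrow> g \<le> risk True m u"
    and "\<And>u. u \<in> confounder_levels \<mu> C U c \<Longrightarrow> risk True m u \<le> y * g"
proof -
  let ?V = "confounder_levels \<mu> C U c"
  let ?g = "MIN u\<in>?V. risk True m u" and ?h = "MAX u\<in>?V. risk True m u"
  have "ratio ?h ?g \<le> RR_UY \<mu> A Y M C U Yam c"
    unfolding RR_UY_def outcome_prob_eq_risk using m by (intro Max_ge) auto
  also note assms(1)
  finally have le: "ratio ?h ?g \<le> ereal y" .
  have g: "0 \<le> ?g"
    using ne by (subst Min_ge_iff) (auto simp: cond_prob_def)
  show thesis
  proof
    show "0 \<le> ?g" by (fact g)
    show "?g \<le> risk True m u" if "u \<in> ?V" for u
      using that by (intro Min_le) auto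
    show "risk True m u \<le> y * ?g" if "u \<in> ?V" for u
    proof -
      have "risk True m u \<le> ?h"
        using that by (intro Max_ge) auto
      also have "\<dots> \<le> y * ?g"
        using le g by (rule ratio_le_imp_le_mult)
      finally show ?thesis .
    qed
  qed
qed

text \<open>
  A mean under \<open>p\<^sub>1\<close> is at most \<open>x\<close> times the mean under \<open>p\<^sub>0\<close>, and any two means of a function with
  values in \<open>[g, y g]\<close> differ by a factor of at most \<open>y\<close>. The positive exposed mean guarantees that
  the quantity divided by, the unexposed mean or \<open>g\<close>, is positive.
\<close>

lemma stratum_bounds:
  assumes m: "m \<in> mediator_levels \<mu> A M C c"
    and m1: "\<P>(\<omega> in \<mu>. M \<omega> = m \<bar> A \<omega> = True \<and> C \<omega> = c) > 0"
    and rho: "1 \<le> \<rho>"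
    and le: "\<rho> * standardized_outcome True False m \<le> standardized_outcome True True m"
    and pos: "0 < standardized_outcome True True m"
  shows RR_AU_bound: "RR_AU \<mu> A M C U c \<le> ereal x \<Longrightarrow> \<rho> \<le> x"
    and RR_UY_bound: "RR_UY \<mu> A Y M C U Yam c \<le> ereal y \<Longrightarrow> \<rho> \<le> y"
    and joint_bound: "\<lbrakk>RR_AU \<mu> A M C U c \<le> ereal x; RR_UY \<mu> A Y M C U Yam c \<le> ereal y\<rbrakk>
      \<Longrightarrow> \<rho> * (x + y - 1) \<le> x * y"
proof -
  let ?V = "confounder_levels \<mu> C U c"
  let ?p = "\<lambda>a u. confounder_prob \<mu> A M C U a m c u"
  let ?f = "risk True m"
  let ?N = "\<lambda>a. standardized_outcome True a m"
  have total: "(\<Sum>u\<in>?V. ?p a u) = 1" for a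
    using m m1 by (cases a) (auto intro!: sum_confounder_prob simp: mediator_levels_def)
  then have ne: "?V \<noteq> {}" by (metis sum.empty zero_neq_one)
  have mean_ge: "b \<le> ?N a" if "\<And>u. u \<in> ?V \<Longrightarrow> b \<le> ?f u" for a b
  proof -
    have "(\<Sum>u\<in>?V. b * ?p a u) \<le> ?N a"
      using that by (intro sum_mono mult_right_mono confounder_prob_nonneg)
    then show ?thesis by (simp add: total flip: sum_distrib_left)
  qed
  have mean_le: "?N a \<le> b" if "\<And>u. u \<in> ?V \<Longrightarrow> ?f u \<le> b" for a b
  proof -
    have "?N a \<le> (\<Sum>u\<in>?V. b * ?p a u)"
      using that by (intro sum_mono mult_right_mono confounder_prob_nonneg)
    then show ?thesis by (simp add: total flip: sum_distrib_left)
  qed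
  show AU: "\<rho> \<le> x" if "RR_AU \<mu> A M C U c \<le> ereal x" for x
  proof -
    have "?N True \<le> (\<Sum>u\<in>?V. ?f u * (x * ?p False u))"
      by (intro sum_mono mult_left_mono confounder_prob_le[OF that m]) (simp_all add: cond_prob_def)
    also have "\<dots> = x * ?N False"
      by (simp add: sum_distrib_left mult_ac)
    finally have x: "?N True \<le> x * ?N False" .
    have "0 \<le> ?N False"
      by (rule mean_ge) (simp add: cond_prob_def)
    with x pos have "0 < ?N False"
      by (cases "?N False = 0") auto
    moreover have "\<rho> * ?N False \<le> x * ?N False"
      using le x by (rule order_trans)
    ultimately show ?thesis by simp
  qed
  show "\<rho> \<le> y" if y: "RR_UY \<mu> A Y M C U Yam c \<le> ereal y"
  proof -
    obtain g where g: "0 \<le> g" "\<And>u. u \<in> ?V \<Longrightarrow> g \<le> ?f u" "\<And>u. u \<in> ?V \<Longrightarrow> ?f u \<le> y * g"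
      using risk_le[OF y m ne] by blast
    have y: "?N True \<le> y * g" using g(3) by (rule mean_le)
    with pos g(1) have "0 < g" by (cases "g = 0") auto
    moreover have "\<rho> * g \<le> \<rho> * ?N False"
      using rho mean_ge[OF g(2)] by (intro mult_left_mono) auto
    then have "\<rho> * g \<le> y * g" using le y by linarith
    ultimately show ?thesis by simp
  qed
  show "\<rho> * (x + y - 1) \<le> x * y"
    if x: "RR_AU \<mu> A M C U c \<le> ereal x" and y: "RR_UY \<mu> A Y M C U Yam c \<le> ereal y"
  proof -
    obtain g where g: "0 \<le> g" "\<And>u. u \<in> ?V \<Longrightarrow> g \<le> ?f u" "\<And>u. u \<in> ?V \<Longrightarrow> ?f u \<le> y * g"
      using risk_le[OF y m ne] by blast
    have "?N True \<le> y * g" using g(3) by (rule mean_le)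
    with pos g(1) have "0 < g" by (cases "g = 0") auto
    then show ?thesis
      by (intro weighted_means_bound[of "?p False" ?V "?p True" g ?f y x \<rho>]
        total confounder_prob_nonneg g(2,3) confounder_prob_le[OF x m] rho AU[OF x] le)
  qed
qed

end

section \<open>The bounds on the sensitivity parameters\<close>

theorem theorem5:
  fixes \<mu> :: "'w measure"
    and A Y :: "'w \<Rightarrow> bool"
    and M :: "'w \<Rightarrow> 'm::finite"
    and C :: "'w \<Rightarrow> 'c::finite"
    and U :: "'w \<Rightarrow> 'u::finite"
    and Ya :: "bool \<Rightarrow> 'w \<Rightarrow> bool"
    and Ma :: "bool \<Rightarrow> 'w \<Rightarrow> 'm"
    and Yam :: "bool \<Rightarrow> 'm \<Rightarrow> 'w \<Rightarrow> bool"
    and c :: 'c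
  assumes "mediation \<mu> A Y M C U Ya Ma Yam"
    and "\<P>(\<omega> in \<mu>. C \<omega> = c) > 0"
    and "\<And>a. \<P>(\<omega> in \<mu>. A \<omega> = a \<bar> C \<omega> = c) > 0"
    and "\<And>m. \<P>(\<omega> in \<mu>. M \<omega> = m \<bar> A \<omega> = False \<and> C \<omega> = c) > 0
           \<Longrightarrow> \<P>(\<omega> in \<mu>. M \<omega> = m \<bar> A \<omega> = True \<and> C \<omega> = c) > 0"
    and "\<P>(\<omega> in \<mu>. nested_outcome Yam Ma False False \<omega> \<bar> C \<omega> = c) > 0"
    and "standardized_risk \<mu> A Y M C False c > 0"
    and "\<And>a m. cond_indep \<mu> (Yam a m) A (\<lambda>\<omega>. (C \<omega>, U \<omega>))"
    and "\<And>a m. cond_indep \<mu> (Yam a m) M (\<lambda>\<omega>. (A \<omega>, C \<omega>, U \<omega>))"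
    and "\<And>a. cond_indep \<mu> (Ma a) A (\<lambda>\<omega>. (C \<omega>, U \<omega>))"
    and "\<And>a a' m. cond_indep \<mu> (Yam a m) (Ma a') (\<lambda>\<omega>. (C \<omega>, U \<omega>))"
    and "cond_indep \<mu> A U C"
    and "NDE_obs \<mu> A Y M C c > NDE_true \<mu> C Ma Yam c"
    and "NDE_true \<mu> C Ma Yam c > 0"
  shows "RR_AU \<mu> A M C U c \<ge> ereal (NDE_obs \<mu> A Y M C c / NDE_true \<mu> C Ma Yam c)
    \<and> RR_UY \<mu> A Y M C U Yam c \<ge> ereal (NDE_obs \<mu> A Y M C c / NDE_true \<mu> C Ma Yam c)
    \<and> max (RR_AU \<mu> A M C U c) (RR_UY \<mu> A Y M C U Yam c)
        \<ge> ereal ((NDE_obs \<mu> A Y M C c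
                   + sqrt (NDE_obs \<mu> A Y M C c * (NDE_obs \<mu> A Y M C c - NDE_true \<mu> C Ma Yam c)))
                 / NDE_true \<mu> C Ma Yam c)"
proof -
  interpret unconfounded_mediation \<mu> A Y M C U Ya Ma Yam c
    by (intro unconfounded_mediation.intro unconfounded_mediation_axioms.intro assms)
  let ?L = "mediator_levels \<mu> A M C c"
  define D where "D = \<P>(\<omega> in \<mu>. nested_outcome Yam Ma False False \<omega> \<bar> C \<omega> = c)"
  define T where "T = \<P>(\<omega> in \<mu>. nested_outcome Yam Ma True False \<omega> \<bar> C \<omega> = c)"
  define S where "S = standardized_risk \<mu> A Y M C True c"
  define \<rho> where "\<rho> = S / T"
  have D: "0 < D" using assms(5) by (simp add: D_def)
  have true: "NDE_true \<mu> C Ma Yam c = T / D"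
    by (simp add: NDE_true_def T_def D_def)
  have obs: "NDE_obs \<mu> A Y M C c = S / D"
    by (simp add: NDE_obs_def S_def D_def nested_risk_eq standardized_risk_eq)
  have T: "0 < T" and ST: "T < S"
    using assms(12,13) D by (simp_all add: true obs divide_less_cancel zero_less_divide_iff)
  have rho: "1 < \<rho>" using T ST by (simp add: \<rho>_def)
  have T_eq: "T = (\<Sum>m\<in>?L. weight m * standardized_outcome True False m)"
    unfolding T_def by (rule nested_risk_eq)
  have S_eq: "S = (\<Sum>m\<in>?L. weight m * standardized_outcome True True m)"
    unfolding S_def by (rule standardized_risk_eq)
  obtain m where m: "m \<in> ?L"
    and le: "\<rho> * standardized_outcome True False m \<le> standardized_outcome True True m"
    and pos: "0 < standardized_outcome True True m"
  proof (rule exists_weighted_term_ge[of ?L weight "standardized_outcome True False" \<rho>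
        "standardized_outcome True True"])
    show "\<rho> * (\<Sum>m\<in>?L. weight m * standardized_outcome True False m)
        \<le> (\<Sum>m\<in>?L. weight m * standardized_outcome True True m)"
      unfolding T_eq[symmetric] S_eq[symmetric] using T by (simp add: \<rho>_def)
    show "0 < (\<Sum>m\<in>?L. weight m * standardized_outcome True True m)"
      unfolding S_eq[symmetric] using T ST by simp
    show "0 \<le> standardized_outcome True False m" for m
      by (intro sum_nonneg mult_nonneg_nonneg confounder_prob_nonneg) (simp add: cond_prob_def)
  qed (use rho in \<open>auto simp: mediator_levels_def\<close>)
  have m1: "\<P>(\<omega> in \<mu>. M \<omega> = m \<bar> A \<omega> = True \<and> C \<omega> = c) > 0"
    using m by (intro assms(4)) (simp add: mediator_levels_def)
  note bounds = stratum_bounds[OF m m1 less_imp_le[OF rho] le pos]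
  have ratio: "NDE_obs \<mu> A Y M C c / NDE_true \<mu> C Ma Yam c = \<rho>"
    using D by (simp add: true obs \<rho>_def)
  define r where "r = sqrt (\<rho> * (\<rho> - 1))"
  (* The common denominator D cancels, so the target depends on the effects only through \<rho>. *)
  have "sqrt (S / D * (S / D - T / D)) = sqrt (\<rho> * (\<rho> - 1) * (T / D)\<^sup>2)"
    using T D by (simp add: \<rho>_def power2_eq_square field_simps)
  also have "\<dots> = r * (T / D)"
    using T D by (simp add: r_def real_sqrt_mult)
  finally have sqrt_eq: "sqrt (S / D * (S / D - T / D)) = r * (T / D)" .
  have root: "(NDE_obs \<mu> A Y M C c
        + sqrt (NDE_obs \<mu> A Y M C c * (NDE_obs \<mu> A Y M C c - NDE_true \<mu> C Ma Yam c)))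
      / NDE_true \<mu> C Ma Yam c = \<rho> + r"
    unfolding true obs sqrt_eq \<rho>_def using T D by (simp add: field_simps)
  show ?thesis
    unfolding root unfolding ratio r_def
  proof (intro conjI ereal_le_if_le_real_upper_bounds)
    fix z assume z: "max (RR_AU \<mu> A M C U c) (RR_UY \<mu> A Y M C U Yam c) \<le> ereal z"
    have "\<rho> * (z + z - 1) \<le> z * z"
      using z by (intro bounds(3)) auto
    moreover have "\<rho> \<le> z"
      using z by (intro bounds(1)) auto
    ultimately show "\<rho> + sqrt (\<rho> * (\<rho> - 1)) \<le> z"
      using rho by (intro sharp_root_bound) auto
  qed (fact bounds(1,2))+
qed

end
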